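(* Let $H$ be an infinite finitely generated amenable group and let $F_2$ be the free group on two generators. There exists a faithful, transitive action of $F_2$ by permutations on the set $H$ such that every $H$-invariant mean on $H$ is $F_2$-invariant.
   Context: A mean on $H$ is a finitely additive $\mu:2^H\to[0,1]$ with $\mu(H)=1$; it is $H$-invariant if $\mu(hA)=\mu(A)$ for all $h\in H$, $A\subseteq H$ (invariance under left multiplication), and $F_2$-invariant if $\mu(gA)=\mu(A)$ for all $g\in F_2$. Faithful means every nontrivial element of $F_2$ moves some point. *)

theory Defs
  imports Complex_Main "HOL-Algebra.Coset" "HOL-Algebra.Bij" "HOL-Algebra.Generated_Groups"
begin

text \<open>A letter is (generator, sign): generator False = a, True = b; sign True = positive exponent.\<close>

type_synonym letter = "bool \<times> bool"

definition inv_letter :: "letter \<Rightarrow> letter" where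
  "inv_letter l = (fst l, \<not> snd l)"

definition reduced_word :: "letter list \<Rightarrow> bool" where
  "reduced_word w \<longleftrightarrow> (\<forall>i. Suc i < length w \<longrightarrow> w ! Suc i \<noteq> inv_letter (w ! i))"

definition red_cons :: "letter \<Rightarrow> letter list \<Rightarrow> letter list" where
  "red_cons x w = (case w of [] \<Rightarrow> [x] | y # ys \<Rightarrow> (if y = inv_letter x then ys else x # w))"

definition F2 :: "letter list monoid" where
  "F2 = \<lparr>carrier = {w. reduced_word w}, mult = (\<lambda>w v. foldr red_cons w v), one = []\<rparr>"

definition is_mean :: "('a, 'b) monoid_scheme \<Rightarrow> ('a set \<Rightarrow> real) \<Rightarrow> bool" where
  "is_mean H \<mu> \<longleftrightarrow>
     (\<forall>A. A \<subseteq> carrier H \<longrightarrow> 0 \<le> \<mu> A \<and> \<mu> A \<le> 1) \<and>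
     \<mu> (carrier H) = 1 \<and>
     (\<forall>A B. A \<subseteq> carrier H \<longrightarrow> B \<subseteq> carrier H \<longrightarrow> A \<inter> B = {} \<longrightarrow> \<mu> (A \<union> B) = \<mu> A + \<mu> B)"

definition H_invariant_mean :: "('a, 'b) monoid_scheme \<Rightarrow> ('a set \<Rightarrow> real) \<Rightarrow> bool" where
  "H_invariant_mean H \<mu> \<longleftrightarrow> is_mean H \<mu> \<and>
     (\<forall>h \<in> carrier H. \<forall>A. A \<subseteq> carrier H \<longrightarrow> \<mu> (h <#\<^bsub>H\<^esub> A) = \<mu> A)"

definition amenable :: "('a, 'b) monoid_scheme \<Rightarrow> bool" where
  "amenable H \<longleftrightarrow> (\<exists>\<mu>. H_invariant_mean H \<mu>)"

definition finitely_generated :: "('a, 'b) monoid_scheme \<Rightarrow> bool" where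
  "finitely_generated H \<longleftrightarrow> (\<exists>S. finite S \<and> S \<subseteq> carrier H \<and> generate H S = carrier H)"

text \<open>An action of F2 on S: a group homomorphism into the group of bijections of S.\<close>

definition faithful_action :: "'a set \<Rightarrow> (letter list \<Rightarrow> 'a \<Rightarrow> 'a) \<Rightarrow> bool" where
  "faithful_action S \<phi> \<longleftrightarrow>
     (\<forall>g \<in> carrier F2. g \<noteq> \<one>\<^bsub>F2\<^esub> \<longrightarrow> (\<exists>x \<in> S. \<phi> g x \<noteq> x))"

definition transitive_action :: "'a set \<Rightarrow> (letter list \<Rightarrow> 'a \<Rightarrow> 'a) \<Rightarrow> bool" where
  "transitive_action S \<phi> \<longleftrightarrow> (\<forall>x \<in> S. \<forall>y \<in> S. \<exists>g \<in> carrier F2. \<phi> g x = y)"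

definition F2_invariant_mean ::
    "('a, 'b) monoid_scheme \<Rightarrow> (letter list \<Rightarrow> 'a \<Rightarrow> 'a) \<Rightarrow> ('a set \<Rightarrow> real) \<Rightarrow> bool" where
  "F2_invariant_mean H \<phi> \<mu> \<longleftrightarrow>
     (\<forall>g \<in> carrier F2. \<forall>A. A \<subseteq> carrier H \<longrightarrow> \<mu> (\<phi> g ` A) = \<mu> A)"

end

theory Submission
  imports Defs "HOL-Library.Countable"
begin

text \<open>A permutation \<open>f\<close> of \<open>H\<close> such that \<open>f x * inverse x\<close> takes only finitely many values is a
  piecewise left translation with finitely many pieces, so it preserves every invariant mean. Hence
  it suffices to find two such permutations generating a free group that acts transitively.

  Take the spanning tree of \<open>H\<close> given by word length and an infinite ray in it; write \<open>x i\<close> and \<open>y i\<close>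
  for its vertices of index \<open>2 i\<close> and \<open>2 i + 1\<close>. Fix an infinite reduced sequence \<open>\<epsilon>\<close> of letters that
  contains every reduced word as a factor. Requiring that the letter \<open>\<epsilon> i\<close> takes \<open>x (i + 1)\<close> to \<open>x i\<close>
  makes each generator a partial injection of the \<open>x i\<close>, and forces faithfulness; letting it act
  inversely on the \<open>y i\<close> and change sides where it is undefined makes it a permutation (\<open>glide\<close>).
  The rest of the tree is absorbed by composing with finite cycles (\<open>spin\<close>) on stars, each
  consisting of a vertex and its children off the ray. Assigning stars to the two generators by the
  parity of the depth makes the stars of one generator disjoint; the children of \<open>x i\<close> are attached
  to \<open>y i\<close> instead, so that the cycles fix every \<open>x i\<close> and do not disturb the words read there.\<close>

section \<open>Reduced words and word maps\<close>

lemma inv_letter_inv_letter [simp]: "inv_letter (inv_letter l) = l"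
  by (simp add: inv_letter_def)

lemma fst_inv_letter [simp]: "fst (inv_letter l) = fst l"
  and snd_inv_letter [simp]: "snd (inv_letter l) = (\<not> snd l)"
  by (simp_all add: inv_letter_def)

lemma reduced_word_iff_successively:
  "reduced_word w \<longleftrightarrow> successively (\<lambda>x y. y \<noteq> inv_letter x) w"
  by (auto simp: reduced_word_def successively_conv_nth)

lemma reduced_word_red_cons:
  assumes "reduced_word w"
  shows "reduced_word (red_cons l w)"
proof (cases w)
  case (Cons y ys)
  with assms show ?thesis
    by (cases ys) (auto simp: reduced_word_iff_successively red_cons_def successively_Cons)
qed (simp add: red_cons_def reduced_word_def)

text \<open>At most two of the four letters are forbidden. For an empty \<open>u\<close> or
  \<open>v\<close> the arbitrary value of \<open>last\<close> or \<open>hd\<close> merely excludes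
  one more letter.\<close>

lemma ex_separating_letter:
  assumes "reduced_word u" "reduced_word v"
  shows "\<exists>s. reduced_word (u @ s # v)"
proof -
  have "\<not> UNIV \<subseteq> {inv_letter (last u), inv_letter (hd v)}"
  proof
    assume "UNIV \<subseteq> {inv_letter (last u), inv_letter (hd v)}"
    then have "card (UNIV :: letter set) \<le> card {inv_letter (last u), inv_letter (hd v)}"
      by (intro card_mono) auto
    also have "\<dots> \<le> 2"
      by (simp add: card_insert_if)
    finally show False
      by (simp add: card_cartesian_product flip: UNIV_Times_UNIV)
  qed
  then obtain s where s: "s \<noteq> inv_letter (last u)" "s \<noteq> inv_letter (hd v)"
    by blast
  then have "hd v \<noteq> inv_letter s"
    by (metis inv_letter_inv_letter)
  with s assms have "reduced_word (u @ s # v)"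
    by (auto simp: reduced_word_iff_successively successively_append_iff successively_Cons)
  then show ?thesis ..
qed

text \<open>Concatenate an enumeration of all reduced words, inserting a separating letter before
  each, and pass to the limit.\<close>

lemma ex_universal_reduced_sequence:
  "\<exists>\<epsilon> :: nat \<Rightarrow> letter. (\<forall>i. \<epsilon> (Suc i) \<noteq> inv_letter (\<epsilon> i)) \<and>
     (\<forall>w. reduced_word w \<longrightarrow> (\<exists>i. \<forall>j<length w. \<epsilon> (i + j) = w ! j))"
proof -
  define v :: "nat \<Rightarrow> letter list"
    where "v n = (if reduced_word (from_nat n) then from_nat n else [])" for n
  have v: "reduced_word (v n)" for n
    by (simp add: v_def reduced_word_def)
  have "\<exists>W. \<forall>n. reduced_word (W n) \<and> (\<exists>s. W (Suc n) = W n @ s # v n)"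
  proof (rule dependent_nat_choice)
    show "\<exists>w. reduced_word w"
      using v by blast
    show "\<exists>w'. reduced_word w' \<and> (\<exists>s. w' = w @ s # v n)" if "reduced_word w" for w n
      using ex_separating_letter[OF that v] by blast
  qed
  then obtain W where W: "\<And>n. reduced_word (W n)" and Suc: "\<And>n. \<exists>s. W (Suc n) = W n @ s # v n"
    by blast
  have len: "n \<le> length (W n)" for n
  proof (induction n)
    case (Suc n)
    then show ?case
      using \<open>\<exists>s. W (Suc n) = W n @ s # v n\<close> by auto
  qed simp
  have ext: "\<exists>xs. W n = W m @ xs" if "m \<le> n" for m n
    using that
  proof (induction n rule: dec_induct)
    case (step n)
    then show ?case
      using Suc[of n] by auto
  qed simp
  \<comment> \<open>\<open>W (Suc i)\<close> has more than \<open>i\<close> letters and each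
    \<open>W n\<close> is a prefix of the next, so this reads off their common limit.\<close>
  define \<epsilon> where "\<epsilon> i = W (Suc i) ! i" for i
  have eps: "\<epsilon> i = W n ! i" if "i < length (W n)" for i n
  proof (cases "Suc i \<le> n")
    case True
    then obtain xs where "W n = W (Suc i) @ xs"
      using ext by blast
    then show ?thesis
      using len[of "Suc i"] by (simp add: \<epsilon>_def nth_append)
  next
    case False
    then obtain xs where "W (Suc i) = W n @ xs"
      using ext[of n "Suc i"] by auto
    then show ?thesis
      using that by (simp add: \<epsilon>_def nth_append)
  qed
  have "\<epsilon> (Suc i) \<noteq> inv_letter (\<epsilon> i)" for i
    using W[of "Suc (Suc i)"] len[of "Suc (Suc i)"]
    by (simp add: eps[of _ "Suc (Suc i)"] reduced_word_def)
  moreover have "\<exists>i. \<forall>j<length w. \<epsilon> (i + j) = w ! j" if "reduced_word w" for w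
  proof -
    define n where "n = to_nat w"
    have "v n = w"
      using that by (simp add: v_def n_def)
    then obtain s where "W (Suc n) = (W n @ [s]) @ w"
      using Suc[of n] by auto
    then have "\<epsilon> (Suc (length (W n)) + j) = w ! j" if "j < length w" for j
      using that eps[of "Suc (length (W n)) + j" "Suc n"] by (simp add: nth_append)
    then show ?thesis
      by blast
  qed
  ultimately show ?thesis
    by blast
qed

section \<open>Evaluating words at two group elements\<close>

context group
begin

definition letter_map :: "(bool \<Rightarrow> 'a) \<Rightarrow> letter \<Rightarrow> 'a" where
  "letter_map a l = (if snd l then a (fst l) else inv (a (fst l)))"

definition word_map :: "(bool \<Rightarrow> 'a) \<Rightarrow> letter list \<Rightarrow> 'a" where
  "word_map a w = foldr (\<lambda>l g. letter_map a l \<otimes> g) w \<one>"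

lemma word_map_simps [simp]:
  "word_map a [] = \<one>"
  "word_map a (l # w) = letter_map a l \<otimes> word_map a w"
  by (simp_all add: word_map_def)

context
  fixes a :: "bool \<Rightarrow> 'a"
  assumes a: "\<And>k. a k \<in> carrier G"
begin

lemma letter_map_closed [simp]: "letter_map a l \<in> carrier G"
  by (simp add: letter_map_def a)

lemma letter_map_inv_letter: "letter_map a (inv_letter l) = inv (letter_map a l)"
  by (simp add: letter_map_def a)

lemma word_map_closed [simp]: "word_map a w \<in> carrier G"
  by (induction w) simp_all

text \<open>Cancelling a letter against its inverse leaves the product unchanged; this is what makes
  \<open>word_map\<close> multiplicative on \<open>F2\<close>.\<close>

lemma word_map_red_cons: "word_map a (red_cons l w) = letter_map a l \<otimes> word_map a w"
  by (cases w) (auto simp: red_cons_def letter_map_inv_letter m_assoc [symmetric])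

lemma word_map_hom: "word_map a \<in> hom F2 G"
proof (rule homI)
  fix w v
  have "word_map a (foldr red_cons w v) = word_map a w \<otimes> word_map a v"
    by (induction w) (simp_all add: word_map_red_cons m_assoc)
  then show "word_map a (w \<otimes>\<^bsub>F2\<^esub> v) = word_map a w \<otimes> word_map a v"
    by (simp add: F2_def)
qed simp

end

end

section \<open>Cyclic permutations of fibres\<close>

text \<open>Transport the shift modulo \<open>n\<close> along an enumeration of
  \<open>F\<close>.\<close>

lemma ex_cyclic_permutation:
  assumes "finite F"
  shows "\<exists>f. bij_betw f F F \<and> (\<forall>u\<in>F. \<forall>v\<in>F. \<exists>j. u = (f ^^ j) v)"
proof -
  define n where "n = card F"
  obtain h where h: "bij_betw h {0..<n} F"
    using ex_bij_betw_nat_finite[OF assms] unfolding n_def by blast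
  define g where "g = inv_into {0..<n} h"
  have hg: "h (g u) = u" "g u < n" if "u \<in> F" for u
    using that h bij_betw_inv_into_right[OF h that] bij_betw_inv_into[OF h]
    by (auto simp: g_def dest: bij_betwE)
  have gh: "g (h i) = i" if "i < n" for i
    using h that by (simp add: g_def bij_betw_inv_into_left)
  have hF: "h i \<in> F" if "i < n" for i
    using h that by (auto dest: bij_betwE)
  define f where "f u = h (Suc (g u) mod n)" for u
  have fF: "f u \<in> F" if "u \<in> F" for u
    using hg(2)[OF that] by (auto simp: f_def intro!: hF)
  have pow: "(f ^^ j) v = h ((g v + j) mod n)" if "v \<in> F" for v j
  proof (induction j)
    case (Suc j)
    have "n > 0"
      using hg(2)[OF that] by simp
    have "(f ^^ Suc j) v = f (h ((g v + j) mod n))"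
      using Suc by simp
    also have "\<dots> = h (Suc ((g v + j) mod n) mod n)"
      unfolding f_def using \<open>n > 0\<close> by (simp add: gh)
    finally show ?case
      by (simp add: mod_Suc_eq)
  qed (use hg[OF that] in simp)
  have ex: "\<exists>j. u = (f ^^ j) v" if "u \<in> F" "v \<in> F" for u v
  proof
    \<comment> \<open>Since \<open>g v < n\<close>, the first \<open>n - g v\<close> steps close the
      cycle and the remaining ones advance to \<open>g u\<close>.\<close>
    have "(g v + (n - g v + g u)) mod n = g u"
      using hg(2)[OF \<open>u \<in> F\<close>] hg(2)[OF \<open>v \<in> F\<close>] by simp
    then show "u = (f ^^ (n - g v + g u)) v"
      using that by (simp add: pow hg)
  qed
  \<comment> \<open>Cyclicity leads from \<open>f u\<close> back to \<open>u\<close>, which gives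
    surjectivity; finiteness then gives injectivity.\<close>
  have "F \<subseteq> f ` F"
  proof
    fix u assume u: "u \<in> F"
    then obtain j where "u = (f ^^ j) (f u)"
      using ex fF by blast
    then have "u = f ((f ^^ j) u)"
      by (simp flip: funpow_swap1)
    moreover have "(f ^^ j) u \<in> F"
      by (induction j) (auto simp: u fF)
    ultimately show "u \<in> f ` F"
      by blast
  qed
  then have "bij_betw f F F"
    using fF assms by (auto simp: bij_betw_def intro: finite_surj_inj)
  with ex show ?thesis
    by blast
qed

text \<open>The cycles of the single fibres are glued. Each preserves its fibre, so the result is
  bijective and its iterates on a fibre are those of the cycle there.\<close>

lemma ex_fibrewise_cyclic_permutation:
  assumes fin: "\<And>v. v \<in> V \<Longrightarrow> finite {u \<in> V. \<rho> u = \<rho> v}"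
  shows "\<exists>\<sigma>. bij_betw \<sigma> V V \<and> (\<forall>v\<in>V. \<rho> (\<sigma> v) = \<rho> v) \<and>
    (\<forall>u\<in>V. \<forall>v\<in>V. \<rho> u = \<rho> v \<longrightarrow> (\<exists>j. u = (\<sigma> ^^ j) v))"
proof -
  define F where "F x = {u \<in> V. \<rho> u = x}" for x
  have "\<forall>x. \<exists>f. bij_betw f (F x) (F x) \<and> (\<forall>u\<in>F x. \<forall>v\<in>F x. \<exists>j. u = (f ^^ j) v)"
  proof
    fix x
    have "finite (F x)"
    proof (cases "F x = {}")
      case False
      then obtain v where "v \<in> V" "\<rho> v = x"
        by (auto simp: F_def)
      then show ?thesis
        using fin[of v] by (simp add: F_def)
    qed simp
    then show "\<exists>f. bij_betw f (F x) (F x) \<and> (\<forall>u\<in>F x. \<forall>v\<in>F x. \<exists>j. u = (f ^^ j) v)"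
      by (rule ex_cyclic_permutation)
  qed
  then obtain f where bij: "\<And>x. bij_betw (f x) (F x) (F x)"
    and cyc: "\<And>x u v. u \<in> F x \<Longrightarrow> v \<in> F x \<Longrightarrow> \<exists>j. u = (f x ^^ j) v"
    by metis
  define \<sigma> where "\<sigma> u = f (\<rho> u) u" for u
  have \<sigma>F: "\<sigma> u \<in> F (\<rho> u)" if "u \<in> V" for u
    using bij[of "\<rho> u"] that unfolding \<sigma>_def by (auto simp: F_def dest: bij_betwE)
  have "bij_betw \<sigma> V V"
  proof (rule bij_betw_imageI)
    show "inj_on \<sigma> V"
    proof (rule inj_onI)
      fix u v assume uv: "u \<in> V" "v \<in> V" "\<sigma> u = \<sigma> v"
      then have "\<rho> u = \<rho> v"
        using \<sigma>F[of u] \<sigma>F[of v] by (simp add: F_def)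
      with uv bij[of "\<rho> u"] show "u = v"
        by (auto simp: \<sigma>_def F_def bij_betw_def inj_on_def)
    qed
    show "\<sigma> ` V = V"
    proof
      show "\<sigma> ` V \<subseteq> V"
        using \<sigma>F by (auto simp: F_def)
      show "V \<subseteq> \<sigma> ` V"
      proof
        fix u assume "u \<in> V"
        then have "u \<in> f (\<rho> u) ` F (\<rho> u)"
          using bij[of "\<rho> u"] by (simp add: bij_betw_def F_def)
        then obtain w where "w \<in> V" "\<rho> w = \<rho> u" "u = f (\<rho> u) w"
          by (auto simp: F_def)
        then have "u = \<sigma> w"
          by (simp add: \<sigma>_def)
        with \<open>w \<in> V\<close> show "u \<in> \<sigma> ` V"
          by blast
      qed
    qed
  qed
  moreover have "\<forall>v\<in>V. \<rho> (\<sigma> v) = \<rho> v"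
    using \<sigma>F by (auto simp: F_def)
  moreover have "\<exists>j. u = (\<sigma> ^^ j) v" if uv: "u \<in> V" "v \<in> V" "\<rho> u = \<rho> v" for u v
  proof -
    obtain j where j: "u = (f (\<rho> v) ^^ j) v"
      using cyc[of u "\<rho> v" v] uv unfolding F_def by blast
    have "(\<sigma> ^^ i) v = (f (\<rho> v) ^^ i) v \<and> (\<sigma> ^^ i) v \<in> F (\<rho> v)" for i
    proof (induction i)
      case (Suc i)
      then have in_F: "(\<sigma> ^^ i) v \<in> F (\<rho> v)"
        by blast
      then have "\<sigma> ((\<sigma> ^^ i) v) = f (\<rho> v) ((\<sigma> ^^ i) v)"
        by (simp add: F_def \<sigma>_def)
      moreover have "\<sigma> ((\<sigma> ^^ i) v) \<in> F (\<rho> v)"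
        using in_F \<sigma>F[of "(\<sigma> ^^ i) v"] by (simp add: F_def)
      ultimately show ?case
        using Suc by simp
    qed (simp add: F_def uv)
    with j show ?thesis
      by metis
  qed
  ultimately show ?thesis
    by blast
qed

section \<open>Bounded displacement and invariant means\<close>

lemma is_mean_Union:
  assumes \<mu>: "is_mean H \<mu>" and "finite I"
    and "\<And>i. i \<in> I \<Longrightarrow> A i \<subseteq> carrier H"
    and "\<And>i j. i \<in> I \<Longrightarrow> j \<in> I \<Longrightarrow> i \<noteq> j \<Longrightarrow> A i \<inter> A j = {}"
  shows "\<mu> (\<Union>i\<in>I. A i) = (\<Sum>i\<in>I. \<mu> (A i))"
  using assms(2-)
proof (induction I rule: finite_induct)
  case empty
  \<comment> \<open>Additivity on two empty sets forces \<open>\<mu> {} = 0\<close>.\<close>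
  have "\<mu> ({} \<union> {}) = \<mu> {} + \<mu> {}"
    using \<mu> unfolding is_mean_def by blast
  then show ?case
    by simp
next
  case (insert i I)
  have "\<mu> (A i \<union> (\<Union>i\<in>I. A i)) = \<mu> (A i) + \<mu> (\<Union>i\<in>I. A i)"
  proof -
    have "A i \<inter> (\<Union>i\<in>I. A i) = {}"
      using insert.hyps insert.prems(2)[of i] by fastforce
    moreover have "A i \<subseteq> carrier H" "(\<Union>i\<in>I. A i) \<subseteq> carrier H"
      using insert.prems(1) by blast+
    ultimately show ?thesis
      using \<mu> unfolding is_mean_def by blast
  qed
  moreover have "\<mu> (\<Union>i\<in>I. A i) = (\<Sum>i\<in>I. \<mu> (A i))"
    using insert.prems by (intro insert.IH) auto
  ultimately show ?case
    using insert.hyps by simp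
qed

context group
begin

text \<open>Bounded displacement, measured by the left factor that takes \<open>x\<close> to
  \<open>y\<close> to match left invariance. Using relations instead of maps allows converses and
  compositions of tree edges.\<close>

definition controlled :: "('a \<times> 'a) set \<Rightarrow> bool" where
  "controlled R \<longleftrightarrow> R \<subseteq> carrier G \<times> carrier G \<and> finite ((\<lambda>(x, y). y \<otimes> inv x) ` R)"

lemma controlled_subset: "controlled R \<Longrightarrow> Q \<subseteq> R \<Longrightarrow> controlled Q"
  unfolding controlled_def by (meson finite_subset image_mono subset_trans)

lemma controlled_Un: "controlled R \<Longrightarrow> controlled Q \<Longrightarrow> controlled (R \<union> Q)"
  unfolding controlled_def by (simp add: image_Un)

lemma controlled_Id_on: "controlled (Id_on (carrier G))"
proof -
  have "(\<lambda>(x, y). y \<otimes> inv x) ` Id_on (carrier G) \<subseteq> {\<one>}"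
    by auto
  then show ?thesis
    unfolding controlled_def using finite_subset by blast
qed

lemma controlled_converse:
  assumes "controlled R"
  shows "controlled (R\<inverse>)"
proof -
  have "(\<lambda>(x, y). y \<otimes> inv x) ` R\<inverse> \<subseteq> (\<lambda>k. inv k) ` (\<lambda>(x, y). y \<otimes> inv x) ` R"
  proof (clarify, intro image_eqI)
    fix x y assume "(x, y) \<in> R"
    then have "x \<in> carrier G" "y \<in> carrier G"
      using assms by (auto simp: controlled_def)
    then show "x \<otimes> inv y = inv (y \<otimes> inv x)"
      by (simp add: inv_mult_group)
  qed auto
  then have "finite ((\<lambda>(x, y). y \<otimes> inv x) ` R\<inverse>)"
    using assms unfolding controlled_def by (meson finite_imageI finite_subset)
  then show ?thesis
    using assms by (auto simp: controlled_def)
qed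

text \<open>Displacements multiply along a composition, and products from two finite sets form a
  finite set.\<close>

lemma controlled_relcomp:
  assumes "controlled R" "controlled Q"
  shows "controlled (R O Q)"
proof -
  let ?D = "\<lambda>R. (\<lambda>(x, y). y \<otimes> inv x) ` R"
  have "?D (R O Q) \<subseteq> (\<lambda>(h, k). k \<otimes> h) ` (?D R \<times> ?D Q)"
  proof (clarify, intro image_eqI)
    fix x y z assume "(x, y) \<in> R" "(y, z) \<in> Q"
    moreover from this have "x \<in> carrier G" "y \<in> carrier G" "z \<in> carrier G"
      using assms by (auto simp: controlled_def)
    moreover from this have "inv y \<otimes> (y \<otimes> inv x) = inv x"
      by (simp flip: m_assoc)
    ultimately show "z \<otimes> inv x = (\<lambda>(h, k). k \<otimes> h) (y \<otimes> inv x, z \<otimes> inv y)"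
      and "(y \<otimes> inv x, z \<otimes> inv y) \<in> ?D R \<times> ?D Q"
      by (force simp: m_assoc)+
  qed
  moreover have "finite ((\<lambda>(h, k). k \<otimes> h) ` (?D R \<times> ?D Q))"
    using assms by (auto simp: controlled_def)
  ultimately show ?thesis
    using assms finite_subset unfolding controlled_def by blast
qed

text \<open>A point and a displacement determine the target. This gives finite branching of the tree
  and finite stars.\<close>

lemma controlled_finite_Image:
  assumes "controlled R"
  shows "finite (R `` {x})"
proof -
  have "R `` {x} \<subseteq> (\<lambda>k. k \<otimes> x) ` (\<lambda>(x, y). y \<otimes> inv x) ` R"
  proof
    fix y assume "y \<in> R `` {x}"
    then have "(x, y) \<in> R"
      by simp
    moreover from this have "y = (y \<otimes> inv x) \<otimes> x"
      using assms by (auto simp: controlled_def m_assoc)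
    ultimately show "y \<in> (\<lambda>k. k \<otimes> x) ` (\<lambda>(x, y). y \<otimes> inv x) ` R"
      by force
  qed
  then show ?thesis
    using assms unfolding controlled_def by (meson finite_imageI finite_subset)
qed

definition graph_of :: "('a \<Rightarrow> 'a) \<Rightarrow> ('a \<times> 'a) set" where
  "graph_of f = {(x, f x) | x. x \<in> carrier G}"

lemma invariant_mean_bounded_displacement:
  assumes \<mu>: "H_invariant_mean G \<mu>"
    and f: "bij_betw f (carrier G) (carrier G)" "controlled (graph_of f)"
    and A: "A \<subseteq> carrier G"
  shows "\<mu> (f ` A) = \<mu> A"
proof -
  define K where "K = (\<lambda>(x, y). y \<otimes> inv x) ` graph_of f"
  \<comment> \<open>These are the finitely many pieces on each of which \<open>f\<close> is a left
    translation.\<close>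
  define B where "B k = {x \<in> A. f x \<otimes> inv x = k}" for k
  have K: "finite K" "K \<subseteq> carrier G"
    using f(2) by (auto simp: K_def controlled_def)
  have fG: "f x \<in> carrier G" if "x \<in> carrier G" for x
    using f(1) that by (auto dest: bij_betwE)
  have BG: "B k \<subseteq> carrier G" for k
    using A by (auto simp: B_def)
  have A_eq: "A = (\<Union>k\<in>K. B k)"
    using A by (force simp: B_def K_def graph_of_def)
  have translate: "f ` B k = k <# B k" if "k \<in> K" for k
  proof -
    have "f x = k \<otimes> x" if "x \<in> B k" for x
      using that A fG by (auto simp: B_def m_assoc)
    then show ?thesis
      by (auto simp: l_coset_def)
  qed
  have mean: "is_mean G \<mu>"
    using \<mu> by (simp add: H_invariant_mean_def)
  have "\<mu> (f ` A) = \<mu> (\<Union>k\<in>K. f ` B k)"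
    by (subst A_eq) (simp add: image_UN)
  also have "\<dots> = (\<Sum>k\<in>K. \<mu> (f ` B k))"
  proof (rule is_mean_Union[OF mean K(1)])
    show "f ` B k \<subseteq> carrier G" for k
      using A fG by (auto simp: B_def)
    fix i j :: 'a assume "i \<noteq> j"
    then have "B i \<inter> B j = {}"
      by (auto simp: B_def)
    then show "f ` B i \<inter> f ` B j = {}"
      using f(1) BG unfolding bij_betw_def by (metis image_empty inj_on_image_Int)
  qed
  also have "\<dots> = (\<Sum>k\<in>K. \<mu> (B k))"
  proof (rule sum.cong)
    fix k assume "k \<in> K"
    then show "\<mu> (f ` B k) = \<mu> (B k)"
      using \<mu> K(2) BG unfolding translate[OF \<open>k \<in> K\<close>] H_invariant_mean_def by blast
  qed simp
  also have "\<dots> = \<mu> (\<Union>k\<in>K. B k)"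
    by (rule is_mean_Union[OF mean K(1), symmetric]) (use BG in \<open>auto simp: B_def\<close>)
  also have "\<dots> = \<mu> A"
    using A_eq by simp
  finally show ?thesis .
qed

section \<open>A spanning tree with a ray\<close>

text \<open>\<open>d\<close> is word length and \<open>p\<close> strips the first letter of a
  shortest word. Letters multiply on the left, so \<open>p x\<close> differs from \<open>x\<close>
  by a left factor from a finite set.\<close>

lemma ex_spanning_tree:
  assumes S: "finite S" "S \<subseteq> carrier G" "generate G S = carrier G"
  shows "\<exists>p (d :: 'a \<Rightarrow> nat). p \<one> = \<one> \<and> (\<forall>x\<in>carrier G. x \<noteq> \<one> \<longrightarrow> d x = Suc (d (p x))) \<and>
    controlled (graph_of p)"
proof -
  \<comment> \<open>Inverses are adjoined because \<open>generate\<close> admits them, and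
    \<open>\<one>\<close> so that the root, being its own parent, also satisfies
    \<open>x = k \<otimes> p x\<close>.\<close>
  define K where "K = insert \<one> (S \<union> (\<lambda>s. inv s) ` S)"
  have K: "finite K" "K \<subseteq> carrier G" "\<one> \<in> K"
    using S by (auto simp: K_def)
  define ball where "ball n = ((\<lambda>B. (\<lambda>(k, x). k \<otimes> x) ` (K \<times> B)) ^^ n) {\<one>}" for n
  have ball_0: "ball 0 = {\<one>}" and ball_Suc: "ball (Suc n) = (\<lambda>(k, x). k \<otimes> x) ` (K \<times> ball n)" for n
    by (simp_all add: ball_def)
  have ball_closed: "ball n \<subseteq> carrier G" for n
    using K by (induction n) (auto simp: ball_0 ball_Suc)
  have ball_mult: "x \<otimes> y \<in> ball (m + n)" if "x \<in> ball m" "y \<in> ball n" for x y m n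
    using that(1)
  proof (induction m arbitrary: x)
    case 0
    then show ?case
      using that(2) ball_closed[of n] by (auto simp: ball_0)
  next
    case (Suc m)
    then obtain k z where "k \<in> K" "z \<in> ball m" "x = k \<otimes> z"
      by (auto simp: ball_Suc)
    moreover from this have "x \<otimes> y = k \<otimes> (z \<otimes> y)"
      using K ball_closed that(2) by (metis m_assoc subsetD)
    ultimately show ?case
      using Suc.IH[of z] by (auto simp: ball_Suc)
  qed
  have K_ball: "k \<in> ball 1" if "k \<in> K" for k
  proof -
    have "k = k \<otimes> \<one>"
      using that K by auto
    with that show ?thesis
      unfolding One_nat_def ball_Suc ball_0 by (auto intro!: image_eqI[of _ _ "(k, \<one>)"])
  qed
  have ex_ball: "\<exists>n. x \<in> ball n" if "x \<in> carrier G" for x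
  proof -
    have "x \<in> generate G S"
      using that S by simp
    then show ?thesis
    proof (induction rule: generate.induct)
      case one
      show ?case
        by (rule exI[of _ 0]) (simp add: ball_0)
    next
      case (incl h)
      then show ?case
        by (intro exI[of _ 1] K_ball) (simp add: K_def)
    next
      case (inv h)
      then show ?case
        by (intro exI[of _ 1] K_ball) (simp add: K_def)
    next
      case (eng g h)
      then show ?case
        using ball_mult by blast
    qed
  qed
  define d where "d x = (LEAST n. x \<in> ball n)" for x
  have d_ball: "x \<in> ball (d x)" if "x \<in> carrier G" for x
    unfolding d_def using ex_ball[OF that] by (rule LeastI_ex)
  have d_le: "d x \<le> n" if "x \<in> ball n" for x n
    unfolding d_def using that by (rule Least_le)
  have ex_parent: "\<exists>y k. k \<in> K \<and> y \<in> carrier G \<and> x = k \<otimes> y \<and> d x = Suc (d y)"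
    if x: "x \<in> carrier G" "x \<noteq> \<one>" for x
  proof -
    have "d x \<noteq> 0"
      using d_ball[OF x(1)] x(2) ball_0 by (metis singletonD)
    then obtain n where n: "d x = Suc n"
      by (auto simp: gr0_conv_Suc)
    then obtain k y where ky: "k \<in> K" "y \<in> ball n" "x = k \<otimes> y"
      using d_ball[OF x(1)] by (auto simp: ball_Suc)
    then have y: "y \<in> carrier G"
      using ball_closed by blast
    \<comment> \<open>\<open>y \<in> ball n\<close> gives \<open>d y \<le> n\<close>; prolonging a
      shortest word for \<open>y\<close> by \<open>k\<close> gives
      \<open>n \<le> d y\<close>.\<close>
    have "x \<in> ball (Suc (d y))"
      using ky(1,3) d_ball[OF y] by (auto simp: ball_Suc)
    then have "d x = Suc (d y)"
      using d_le[of x "Suc (d y)"] d_le[OF ky(2)] n by simp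
    with ky y show ?thesis
      by blast
  qed
  then obtain q where q: "\<And>x. x \<in> carrier G \<Longrightarrow> x \<noteq> \<one> \<Longrightarrow>
      q x \<in> carrier G \<and> d x = Suc (d (q x)) \<and> (\<exists>k\<in>K. x = k \<otimes> q x)"
    by metis
  define p where "p x = (if x = \<one> then \<one> else q x)" for x
  have p: "p x \<in> carrier G \<and> d x = Suc (d (p x)) \<and> (\<exists>k\<in>K. x = k \<otimes> p x)"
    if "x \<in> carrier G" "x \<noteq> \<one>" for x
    unfolding p_def if_not_P[OF that(2)] using q[OF that] .
  have p_closed: "p x \<in> carrier G" if "x \<in> carrier G" for x
    using p[OF that] by (cases "x = \<one>") (auto simp: p_def)
  have "p x \<otimes> inv x \<in> (\<lambda>k. inv k) ` K" if x: "x \<in> carrier G" for x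
  proof -
    have "\<exists>k\<in>K. x = k \<otimes> p x"
    proof (cases "x = \<one>")
      case True
      then show ?thesis
        using K by (intro bexI[of _ \<one>]) (auto simp: p_def)
    qed (use p[OF x] in blast)
    then obtain k where k: "k \<in> K" "x = k \<otimes> p x"
      by blast
    then have "k \<in> carrier G"
      using K by blast
    then have "p x \<otimes> inv (k \<otimes> p x) = inv k"
      using p_closed[OF x] by (simp add: inv_mult_group m_assoc [symmetric])
    with k show ?thesis
      by (metis imageI)
  qed
  then have "(\<lambda>(x, y). y \<otimes> inv x) ` graph_of p \<subseteq> (\<lambda>k. inv k) ` K"
    by (auto simp: graph_of_def)
  then have "controlled (graph_of p)"
    using finite_subset[OF _ finite_imageI[OF K(1)]] p_closed
    by (auto simp: controlled_def graph_of_def)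
  moreover have "p \<one> = \<one>"
    by (simp add: p_def)
  ultimately show ?thesis
    using p by blast
qed

lemma ex_ray:
  assumes inf: "infinite (carrier G)"
    and p1: "p \<one> = \<one>"
    and d: "\<And>x. x \<in> carrier G \<Longrightarrow> x \<noteq> \<one> \<Longrightarrow> d x = Suc (d (p x))"
    and ctrl: "controlled (graph_of p)"
  shows "\<exists>r :: nat \<Rightarrow> 'a. r 0 = \<one> \<and> (\<forall>n. r n \<in> carrier G \<and> r (Suc n) \<noteq> \<one> \<and> p (r (Suc n)) = r n)"
proof -
  \<comment> \<open>Koenig's lemma: keep descending to a child with infinitely many descendants \<open>D\<close>.\<close>
  define D where "D v = {u \<in> carrier G. \<exists>k. (p ^^ k) u = v}" for v
  \<comment> \<open>The root is its own parent; it is excluded here so that the descent cannot stall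
    there.\<close>
  define C where "C v = {u \<in> carrier G. u \<noteq> \<one> \<and> p u = v}" for v
  have p_closed: "p x \<in> carrier G" if "x \<in> carrier G" for x
    using ctrl that by (auto simp: controlled_def graph_of_def)
  have C: "finite (C v)" for v
  proof (rule finite_subset)
    show "C v \<subseteq> (graph_of p)\<inverse> `` {v}"
      by (auto simp: C_def graph_of_def)
    show "finite ((graph_of p)\<inverse> `` {v})"
      by (intro controlled_finite_Image controlled_converse ctrl)
  qed
  have "\<exists>k. (p ^^ k) x = \<one>" if "x \<in> carrier G" for x
    using that
  proof (induction "d x" arbitrary: x rule: less_induct)
    case less
    show ?case
    proof (cases "x = \<one>")
      case True
      then show ?thesis
        by (intro exI[of _ 0]) simp
    next
      case False
      then obtain k where "(p ^^ k) (p x) = \<one>"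
        using less d p_closed by (metis lessI)
      then show ?thesis
        by (intro exI[of _ "Suc k"]) (simp add: funpow_swap1)
    qed
  qed
  then have D1: "D \<one> = carrier G"
    by (auto simp: D_def)
  have D_sub: "D v \<subseteq> insert v (\<Union>c\<in>C v. D c)" for v
  proof
    fix u assume "u \<in> D v"
    then obtain k where u: "u \<in> carrier G" and k: "(p ^^ k) u = v"
      by (auto simp: D_def)
    have "u \<in> insert v (\<Union>c\<in>C v. D c)" if "(p ^^ k) u = v"
      using that
    proof (induction k)
      case (Suc k)
      have *: "(p ^^ j) u \<in> carrier G" for j
        using u by (induction j) (auto simp: p_closed)
      show ?case
      proof (cases "(p ^^ k) u = \<one>")
        case True
        then show ?thesis
          using Suc p1 by simp
      next
        case False
        then have "(p ^^ k) u \<in> C v"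
          using Suc.prems * by (simp add: C_def)
        moreover have "u \<in> D ((p ^^ k) u)"
          using u by (auto simp: D_def)
        ultimately show ?thesis
          by blast
      qed
    qed simp
    with k show "u \<in> insert v (\<Union>c\<in>C v. D c)"
      by blast
  qed
  have step: "\<exists>c\<in>C v. infinite (D c)" if "infinite (D v)" for v
  proof (rule ccontr)
    assume "\<not> ?thesis"
    then have "finite (insert v (\<Union>c\<in>C v. D c))"
      using C by auto
    with D_sub[of v] that show False
      using finite_subset by blast
  qed
  have "\<exists>r. \<forall>n. (r n \<in> carrier G \<and> infinite (D (r n)) \<and> (n = 0 \<longrightarrow> r n = \<one>)) \<and> r (Suc n) \<in> C (r n)"
  proof (rule dependent_nat_choice)
    show "\<exists>x. x \<in> carrier G \<and> infinite (D x) \<and> ((0::nat) = 0 \<longrightarrow> x = \<one>)"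
      using inf D1 by auto
  next
    fix x and n :: nat
    assume "x \<in> carrier G \<and> infinite (D x) \<and> (n = 0 \<longrightarrow> x = \<one>)"
    then obtain c where "c \<in> C x" "infinite (D c)"
      using step by blast
    then show "\<exists>y. (y \<in> carrier G \<and> infinite (D y) \<and> (Suc n = 0 \<longrightarrow> y = \<one>)) \<and> y \<in> C x"
      by (auto simp: C_def)
  qed
  then show ?thesis
    by (auto simp: C_def)
qed

end

section \<open>The two generators\<close>

text \<open>\<open>step \<epsilon> k True\<close> is the partial injection that the generator \<open>k\<close> must induce on indices so
  that the letter \<open>\<epsilon> i\<close> takes \<open>Suc i\<close> to \<open>i\<close>; \<open>step \<epsilon> k False\<close> is its inverse.\<close>

definition step :: "(nat \<Rightarrow> letter) \<Rightarrow> bool \<Rightarrow> bool \<Rightarrow> nat \<Rightarrow> nat option" where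
  "step \<epsilon> k s i =
    (if \<epsilon> i = (k, \<not> s) then Some (Suc i)
     else if i > 0 \<and> \<epsilon> (i - 1) = (k, s) then Some (i - 1) else None)"

text \<open>Since \<open>step\<close> tries the upward move first, going back down from
  \<open>Suc i\<close> fails only if \<open>\<epsilon> (Suc i)\<close> is the inverse of
  \<open>\<epsilon> i\<close>, which reducedness excludes.\<close>

lemma step_inverse:
  assumes red: "\<And>i. \<epsilon> (Suc i) \<noteq> inv_letter (\<epsilon> i)" and "step \<epsilon> k s i = Some j"
  shows "step \<epsilon> k (\<not> s) j = Some i"
proof -
  consider "\<epsilon> i = (k, \<not> s)" "j = Suc i" | "\<epsilon> j = (k, s)" "i = Suc j"
    using assms(2) by (auto simp: step_def split: if_splits)
  then show ?thesis
  proof cases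
    case 1
    then have "\<epsilon> (Suc i) \<noteq> (k, s)"
      using red[of i] by (simp add: inv_letter_def)
    with 1 show ?thesis
      by (simp add: step_def)
  next
    case 2
    then show ?thesis
      by (simp add: step_def)
  qed
qed

text \<open>Two copies of the indices turn a partial injection into a permutation: the second copy
  carries the inverse, and undefined values are replaced by a change of copy.\<close>

definition rung :: "(nat \<Rightarrow> letter) \<Rightarrow> bool \<Rightarrow> bool \<Rightarrow> nat \<times> bool \<Rightarrow> nat \<times> bool" where
  "rung \<epsilon> k s z = (case step \<epsilon> k (s \<noteq> snd z) (fst z) of
     Some j \<Rightarrow> (j, snd z) | None \<Rightarrow> (fst z, \<not> snd z))"

text \<open>If a step is undefined, reversing the sign and changing copy leads to the same undefined
  step, so the change of copy is undone.\<close>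

lemma rung_inverse:
  assumes "\<And>i. \<epsilon> (Suc i) \<noteq> inv_letter (\<epsilon> i)"
  shows "rung \<epsilon> k (\<not> s) (rung \<epsilon> k s z) = z"
proof (cases "step \<epsilon> k (s \<noteq> snd z) (fst z)")
  case None
  then show ?thesis
    by (cases z; cases s) (auto simp: rung_def)
next
  case (Some j)
  then show ?thesis
    using step_inverse[OF assms Some] by (cases z; cases s) (auto simp: rung_def)
qed

lemma bij_rung:
  assumes "\<And>i. \<epsilon> (Suc i) \<noteq> inv_letter (\<epsilon> i)"
  shows "bij (rung \<epsilon> k s)"
proof (rule o_bij)
  show "rung \<epsilon> k (\<not> s) \<circ> rung \<epsilon> k s = id"
    using rung_inverse[of \<epsilon>, OF assms] by (simp add: fun_eq_iff)
  show "rung \<epsilon> k s \<circ> rung \<epsilon> k (\<not> s) = id"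
    using rung_inverse[of \<epsilon> k "\<not> s", OF assms] by (simp add: fun_eq_iff)
qed

lemma rung_near:
  "rung \<epsilon> k s (i, b) \<in> {(Suc i, b), (i, \<not> b)} \<or> (\<exists>j. i = Suc j \<and> rung \<epsilon> k s (i, b) = (j, b))"
  by (auto simp: rung_def step_def)

locale group_with_ray = group +
  fixes p :: "'a \<Rightarrow> 'a" and d :: "'a \<Rightarrow> nat" and r :: "nat \<Rightarrow> 'a" and \<epsilon> :: "nat \<Rightarrow> letter"
  assumes p_controlled: "controlled (graph_of p)"
    and depth: "x \<in> carrier G \<Longrightarrow> x \<noteq> \<one> \<Longrightarrow> d x = Suc (d (p x))"
    and r_0: "r 0 = \<one>"
    and r_closed [simp]: "r n \<in> carrier G"
    and r_Suc_neq: "r (Suc n) \<noteq> \<one>"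
    and p_r: "p (r (Suc n)) = r n"
    and reduced: "\<epsilon> (Suc i) \<noteq> inv_letter (\<epsilon> i)"
    and universal: "reduced_word w \<Longrightarrow> \<exists>i. \<forall>j<length w. \<epsilon> (i + j) = w ! j"
begin

lemma p_closed [simp]: "x \<in> carrier G \<Longrightarrow> p x \<in> carrier G"
  using p_controlled by (auto simp: controlled_def graph_of_def)

lemma depth_r: "d (r (Suc n)) = Suc (d (r n))"
  using depth[of "r (Suc n)"] by (simp add: r_Suc_neq p_r)

lemma inj_r: "inj r"
proof -
  have "strict_mono (\<lambda>n. d (r n))"
    by (simp add: strict_mono_Suc_iff depth_r)
  then show ?thesis
    by (metis injI strict_mono_eq)
qed

lemma r_eq_iff [simp]: "r m = r n \<longleftrightarrow> m = n"
  using inj_r by (auto dest: injD)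

text \<open>For a parent map fixing the root this is tree distance at most one. The displacement of
  every map below is bounded by compositions of this relation and its converse.\<close>

definition near :: "('a \<times> 'a) set" where
  "near = Id_on (carrier G) \<union> graph_of p \<union> (graph_of p)\<inverse>"

lemma controlled_near: "controlled near"
  unfolding near_def by (intro controlled_Un controlled_Id_on controlled_converse p_controlled)

lemma near_p: "x \<in> carrier G \<Longrightarrow> (x, p x) \<in> near"
  by (auto simp: near_def graph_of_def)

lemma near_refl: "x \<in> carrier G \<Longrightarrow> (x, x) \<in> near"
  by (auto simp: near_def)

lemma near_r: "(r n, r (Suc n)) \<in> near" "(r (Suc n), r n) \<in> near"
  using p_r[of n] by (force simp: near_def graph_of_def)+

definition near2 :: "('a \<times> 'a) set" where
  "near2 = near O near"

lemma controlled_near2: "controlled near2"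
  unfolding near2_def by (intro controlled_relcomp controlled_near)

text \<open>\<open>ladder (i, False)\<close> and \<open>ladder (i, True)\<close> are
  \<open>x i\<close> and \<open>y i\<close> of the opening comment. Interleaving them on the ray
  makes a change of copy move by one edge and a change of index by one move by two.\<close>

definition ladder :: "nat \<times> bool \<Rightarrow> 'a" where
  "ladder z = r (2 * fst z + of_bool (snd z))"

lemma ladder_closed [simp]: "ladder z \<in> carrier G"
  by (simp add: ladder_def)

lemma ladder_eq_iff [simp]: "ladder z = ladder z' \<longleftrightarrow> z = z'"
proof -
  have "z = z'" if "2 * fst z + of_bool (snd z) = 2 * fst z' + (of_bool (snd z') :: nat)"
    using that by (cases z; cases z') (auto simp: of_bool_def split: if_splits; presburger)
  then show ?thesis
    by (auto simp: ladder_def)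
qed

lemma inj_ladder: "inj ladder"
  by (simp add: inj_def)

lemma range_ladder: "range ladder = range r"
proof
  show "range r \<subseteq> range ladder"
  proof clarify
    fix n
    have "r n = ladder (n div 2, odd n)"
      by (simp add: ladder_def)
    then show "r n \<in> range ladder"
      by blast
  qed
qed (auto simp: ladder_def)

lemma not_range_r_neq_one: "u \<notin> range r \<Longrightarrow> u \<noteq> \<one>"
  using r_0 by (metis rangeI)

definition glide :: "bool \<Rightarrow> 'a \<Rightarrow> 'a" where
  "glide k u = (if u \<in> range ladder then ladder (rung \<epsilon> k True (inv_into UNIV ladder u)) else u)"

lemma glide_ladder [simp]: "glide k (ladder z) = ladder (rung \<epsilon> k True z)"
  by (simp add: glide_def inj_ladder)

lemma glide_off [simp]: "u \<notin> range ladder \<Longrightarrow> glide k u = u"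
  by (simp add: glide_def)

lemma glide_bij: "bij_betw (glide k) (carrier G) (carrier G)"
proof (rule bij_betw_imageI)
  have b: "bij (rung \<epsilon> k True)"
    by (intro bij_rung reduced)
  show "inj_on (glide k) (carrier G)"
  proof (rule inj_onI)
    fix u v assume eq: "glide k u = glide k v"
    have range_iff: "glide k u \<in> range ladder \<longleftrightarrow> u \<in> range ladder" for u
      by (simp add: glide_def)
    show "u = v"
    proof (cases "u \<in> range ladder")
      case True
      then have "v \<in> range ladder"
        using eq range_iff by metis
      with True obtain z z' where "u = ladder z" "v = ladder z'"
        by blast
      with eq show ?thesis
        using bij_is_inj[OF b] by (simp add: inj_eq)
    next
      case False
      then have "v \<notin> range ladder"
        using eq range_iff by metis
      with False eq show ?thesis
        by simp
    qed
  qed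
  show "glide k ` carrier G = carrier G"
  proof
    show "glide k ` carrier G \<subseteq> carrier G"
      by (auto simp: glide_def)
    show "carrier G \<subseteq> glide k ` carrier G"
    proof
      fix u assume u: "u \<in> carrier G"
      show "u \<in> glide k ` carrier G"
      proof (cases "u \<in> range ladder")
        case True
        then obtain z where "u = ladder (rung \<epsilon> k True z)"
          using bij_is_surj[OF b] by (metis rangeE surjD)
        then have "u = glide k (ladder z)"
          by simp
        then show ?thesis
          using ladder_closed by blast
      next
        case False
        then have "u = glide k u"
          by simp
        with u show ?thesis
          by blast
      qed
    qed
  qed
qed

lemma glide_near2:
  assumes "u \<in> carrier G"
  shows "(u, glide k u) \<in> near2"
proof (cases "u \<in> range ladder")
  case True
  then obtain i b where u: "u = ladder (i, b)"
    by auto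
  have up: "(ladder (i, b), ladder (Suc i, b)) \<in> near2" for i
    using near_r(1)[of "2 * i + of_bool b"] near_r(1)[of "Suc (2 * i + of_bool b)"]
    by (auto simp: near2_def ladder_def)
  have down: "(ladder (Suc i, b), ladder (i, b)) \<in> near2" for i
    using near_r(2)[of "2 * i + of_bool b"] near_r(2)[of "Suc (2 * i + of_bool b)"]
    by (auto simp: near2_def ladder_def)
  have "(ladder (i, b), ladder (i, \<not> b)) \<in> near"
    using near_r[of "2 * i"] by (cases b) (auto simp: ladder_def)
  then have swap: "(ladder (i, b), ladder (i, \<not> b)) \<in> near2"
    using near_refl[of "ladder (i, b)"] by (auto simp: near2_def)
  from rung_near[of \<epsilon> k True i b] show ?thesis
    using up down swap by (auto simp: u)
qed (use near_refl[OF assms] in \<open>auto simp: near2_def\<close>)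

section \<open>Stars and their cycles\<close>

definition hub :: "'a \<Rightarrow> 'a" where
  "hub u = (if \<exists>i. p u = ladder (i, False)
     then ladder (THE i. p u = ladder (i, False), True) else p u)"

lemma hub_ladder: "p u = ladder (i, False) \<Longrightarrow> hub u = ladder (i, True)"
  by (auto simp: hub_def)

lemma hub_p: "(\<And>i. p u \<noteq> ladder (i, False)) \<Longrightarrow> hub u = p u"
  by (auto simp: hub_def)

text \<open>The stars of the generator \<open>k\<close> are the fibres of \<open>star_root k\<close>. A ladder vertex \<open>(i, True)\<close> may be
  the root of a star of each generator, which hold the children of \<open>r (2 * i)\<close> and of
  \<open>r (2 * i + 1)\<close> respectively.\<close>

definition star_root :: "bool \<Rightarrow> 'a \<Rightarrow> 'a" where
  "star_root k u = (if u \<notin> range ladder \<and> even (d (p u)) = k then hub u else u)"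

lemma star_root_near2:
  assumes "u \<in> carrier G"
  shows "(u, star_root k u) \<in> near2"
proof -
  have "(p u, hub u) \<in> near"
  proof (cases "\<exists>i. p u = ladder (i, False)")
    case True
    then obtain i where "p u = ladder (i, False)"
      by blast
    then show ?thesis
      using near_r(1)[of "2 * i"] by (simp add: hub_ladder) (simp add: ladder_def)
  qed (use assms in \<open>auto simp: hub_p intro: near_refl\<close>)
  then show ?thesis
    using near_p[OF assms] near_refl[OF assms] by (auto simp: near2_def star_root_def)
qed

lemma star_root_closed [simp]: "u \<in> carrier G \<Longrightarrow> star_root k u \<in> carrier G"
  using star_root_near2 controlled_near2 by (auto simp: controlled_def)

lemma star_root_ladder [simp]: "star_root k (ladder z) = ladder z"
  by (simp add: star_root_def)

text \<open>Ladder vertices are fixed by \<open>star_root\<close>. If \<open>p u\<close> is off the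
  ladder, its own parent has depth of the other parity, so \<open>p u\<close> hangs from a star of
  the other generator only.\<close>

lemma star_root_idem:
  assumes u: "u \<in> carrier G"
  shows "star_root k (star_root k u) = star_root k u"
proof (cases "u \<notin> range ladder \<and> even (d (p u)) = k")
  case True
  then have root: "star_root k u = hub u"
    by (simp add: star_root_def)
  show ?thesis
  proof (cases "p u \<in> range ladder")
    case True
    then have "hub u \<in> range ladder"
      by (cases "\<exists>i. p u = ladder (i, False)") (auto simp: hub_ladder hub_p)
    then show ?thesis
      by (simp add: root) (simp add: star_root_def)
  next
    case False
    then have "hub u = p u"
      by (metis hub_p rangeI)
    moreover have "d (p u) = Suc (d (p (p u)))"
      using u False range_ladder by (intro depth not_range_r_neq_one) auto
    ultimately show ?thesis
      using True unfolding root star_root_def by auto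
  qed
qed (auto simp: star_root_def)

text \<open>\<open>hub\<close> never takes the value \<open>ladder (i, False)\<close>. Hence this
  vertex is alone in its fibre, and \<open>spin\<close> has to fix it.\<close>

lemma star_root_eq_ladder_False:
  assumes "star_root k u = ladder (i, False)"
  shows "u = ladder (i, False)"
  using assms by (cases "\<exists>j. p u = ladder (j, False)")
    (auto simp: star_root_def hub_ladder hub_p split: if_splits)

definition is_spin :: "bool \<Rightarrow> ('a \<Rightarrow> 'a) \<Rightarrow> bool" where
  "is_spin k \<sigma> \<longleftrightarrow> bij_betw \<sigma> (carrier G) (carrier G) \<and>
    (\<forall>v\<in>carrier G. star_root k (\<sigma> v) = star_root k v) \<and>
    (\<forall>u\<in>carrier G. \<forall>v\<in>carrier G. star_root k u = star_root k v \<longrightarrow> (\<exists>j. u = (\<sigma> ^^ j) v))"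

lemma ex_spin: "\<exists>\<sigma>. is_spin k \<sigma>"
  unfolding is_spin_def
proof (rule ex_fibrewise_cyclic_permutation)
  fix v assume "v \<in> carrier G"
  have "{u \<in> carrier G. star_root k u = star_root k v} \<subseteq> near2\<inverse> `` {star_root k v}"
    using star_root_near2[of _ k] by force
  then show "finite {u \<in> carrier G. star_root k u = star_root k v}"
    by (rule finite_subset) (intro controlled_finite_Image controlled_converse controlled_near2)
qed

definition spin :: "bool \<Rightarrow> 'a \<Rightarrow> 'a" where
  "spin k = (SOME \<sigma>. is_spin k \<sigma>)"

lemma is_spin_spin: "is_spin k (spin k)"
  unfolding spin_def using ex_spin by (rule someI_ex)

lemma spin_bij: "bij_betw (spin k) (carrier G) (carrier G)"
  using is_spin_spin[of k] unfolding is_spin_def by (rule conjunct1)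

lemma star_root_spin: "v \<in> carrier G \<Longrightarrow> star_root k (spin k v) = star_root k v"
  using conjunct1[OF conjunct2[OF is_spin_spin[of k, unfolded is_spin_def]]] by (rule bspec)

lemma spin_cyclic:
  assumes "u \<in> carrier G" "v \<in> carrier G" "star_root k u = star_root k v"
  shows "\<exists>j. u = (spin k ^^ j) v"
proof -
  note conjunct2[OF conjunct2[OF is_spin_spin[of k, unfolded is_spin_def]]]
  from bspec[OF bspec[OF this assms(1)] assms(2)] assms(3) show ?thesis
    by (rule mp)
qed

lemma spin_closed [simp]: "v \<in> carrier G \<Longrightarrow> spin k v \<in> carrier G"
  using spin_bij by (auto dest: bij_betwE)

lemma spin_ladder_False [simp]: "spin k (ladder (i, False)) = ladder (i, False)"
proof (rule star_root_eq_ladder_False)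
  show "star_root k (spin k (ladder (i, False))) = ladder (i, False)"
    by (simp add: star_root_spin)
qed

section \<open>The generators and their displacement\<close>

definition gen :: "bool \<Rightarrow> 'a \<Rightarrow> 'a" where
  "gen k = glide k \<circ> spin k"

lemma gen_bij: "bij_betw (gen k) (carrier G) (carrier G)"
  unfolding gen_def by (rule bij_betw_trans[OF spin_bij glide_bij])

text \<open>Whatever cycles were chosen, \<open>u\<close> and \<open>spin k u\<close> are both close
  to their common star root; \<open>glide\<close> adds a bounded move.\<close>

lemma gen_controlled: "controlled (graph_of (gen k))"
proof (rule controlled_subset)
  show "controlled ((near2 O near2\<inverse>) O near2)"
    by (intro controlled_relcomp controlled_converse controlled_near2)
  show "graph_of (gen k) \<subseteq> (near2 O near2\<inverse>) O near2"
  proof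
    fix z assume "z \<in> graph_of (gen k)"
    then obtain u where u: "u \<in> carrier G" "z = (u, glide k (spin k u))"
      by (auto simp: graph_of_def gen_def)
    have "(u, star_root k u) \<in> near2" "(spin k u, star_root k u) \<in> near2"
      using star_root_near2[of u k] star_root_near2[of "spin k u" k] u by (simp_all add: star_root_spin)
    then have "(u, spin k u) \<in> near2 O near2\<inverse>"
      by (intro relcompI[of u "star_root k u"] converseI)
    moreover have "(spin k u, glide k (spin k u)) \<in> near2"
      using u(1) by (intro glide_near2 spin_closed)
    ultimately show "z \<in> (near2 O near2\<inverse>) O near2"
      unfolding u(2) by (rule relcompI)
  qed
qed

lemma gen_ladder_True:
  assumes "\<epsilon> i = (k, True)"
  shows "gen k (ladder (Suc i, False)) = ladder (i, False)"
proof -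
  \<comment> \<open>This rules out the upward move at \<open>Suc i\<close>, which
    \<open>step\<close> would prefer.\<close>
  have "\<epsilon> (Suc i) \<noteq> (k, False)"
    using reduced[of i] assms by (simp add: inv_letter_def)
  with assms show ?thesis
    by (simp add: gen_def rung_def step_def)
qed

lemma gen_ladder_False:
  assumes "\<epsilon> i = (k, False)"
  shows "gen k (ladder (i, False)) = ladder (Suc i, False)"
  using assms by (simp add: gen_def rung_def step_def)

section \<open>Orbits of the generators\<close>

context
  fixes A :: "'a set"
    \<comment> \<open>a union of orbits\<close>
  assumes A: "\<And>k x. x \<in> carrier G \<Longrightarrow> gen k x \<in> A \<longleftrightarrow> x \<in> A"
begin

text \<open>On a star, \<open>gen k\<close> agrees with the cycle \<open>spin k\<close> except at the one vertex that \<open>spin k\<close>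
  maps to the root: walking along the cycle from the root covers the star before leaving it.\<close>

lemma star_root_orbit:
  assumes u: "u \<in> carrier G"
  shows "star_root k u \<in> A \<longleftrightarrow> u \<in> A"
proof -
  define v where "v = star_root k u"
  have v: "v \<in> carrier G" "star_root k v = v"
    using u by (simp_all add: v_def star_root_idem)
  have main: "(spin k ^^ j) v \<in> carrier G \<and> star_root k ((spin k ^^ j) v) = v \<and>
    ((spin k ^^ j) v \<in> A \<longleftrightarrow> v \<in> A)" for j
  proof (induction j)
    case 0
    then show ?case
      using v by simp
  next
    case (Suc j)
    define w where "w = (spin k ^^ j) v"
    have w: "w \<in> carrier G" "star_root k w = v" "w \<in> A \<longleftrightarrow> v \<in> A"
      using Suc by (simp_all add: w_def)
    then have "star_root k (spin k w) = v"
      by (simp add: star_root_spin)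
    moreover have "spin k w \<in> A \<longleftrightarrow> v \<in> A"
    proof (cases "spin k w \<in> range ladder")
      case True
      \<comment> \<open>\<open>star_root\<close> fixes ladder vertices, so a star contains no ladder
        vertex except possibly its root.\<close>
      then have "spin k w = v"
        using \<open>star_root k (spin k w) = v\<close> by (simp add: star_root_def)
      then show ?thesis
        by simp
    next
      case False
      then show ?thesis
        using A[OF w(1), of k] w(3) by (simp add: gen_def)
    qed
    ultimately show ?case
      using w by (simp flip: w_def)
  qed
  obtain j where "u = (spin k ^^ j) v"
    using spin_cyclic[OF u v(1), of k] v(2) by (auto simp: v_def)
  then show ?thesis
    using main[of j] unfolding v_def[symmetric] by metis
qed

text \<open>\<open>spin k\<close> may move \<open>ladder z\<close> before \<open>glide k\<close>
  acts. Its preimage under \<open>spin k\<close> lies in the star rooted at \<open>ladder z\<close>,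
  hence on the same side of \<open>A\<close>, and \<open>gen k\<close> sends that preimage to the
  rung image.\<close>

lemma rung_orbit: "ladder (rung \<epsilon> k True z) \<in> A \<longleftrightarrow> ladder z \<in> A"
proof -
  have "ladder z \<in> spin k ` carrier G"
    using spin_bij[of k] by (simp add: bij_betw_def)
  then obtain u where u: "u \<in> carrier G" "ladder z = spin k u"
    by blast
  then have "star_root k u = ladder z"
    using star_root_spin[OF u(1), of k] by (simp flip: u(2))
  then have "u \<in> A \<longleftrightarrow> ladder z \<in> A"
    using star_root_orbit[OF u(1), of k] by simp
  moreover have "gen k u = ladder (rung \<epsilon> k True z)"
    by (simp add: gen_def flip: u(2))
  ultimately show ?thesis
    using A[OF u(1), of k] by simp
qed

text \<open>The generator of \<open>\<epsilon> i\<close> joins the indices \<open>i\<close> and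
  \<open>Suc i\<close> on both copies, in opposite directions; the copies are joined at index
  0.\<close>

lemma ladder_orbit: "ladder z \<in> A \<longleftrightarrow> \<one> \<in> A"
proof -
  have Suc: "ladder (Suc i, b) \<in> A \<longleftrightarrow> ladder (i, b) \<in> A" for i b
  proof -
    obtain k s where eps: "\<epsilon> i = (k, s)"
      by (cases "\<epsilon> i")
    then have neq: "\<epsilon> (Suc i) \<noteq> (k, \<not> s)"
      using reduced[of i] by (simp add: inv_letter_def)
    show ?thesis
    proof (cases "s = b")
      case True
      with eps have "rung \<epsilon> k True (i, b) = (Suc i, b)"
        by (simp add: rung_def step_def)
      then show ?thesis
        using rung_orbit[of k "(i, b)"] by simp
    next
      case False
      with eps neq have "rung \<epsilon> k True (Suc i, b) = (i, b)"
        by (simp add: rung_def step_def)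
      then show ?thesis
        using rung_orbit[of k "(Suc i, b)"] by simp
    qed
  qed
  have zero: "ladder (0, True) \<in> A \<longleftrightarrow> ladder (0, False) \<in> A"
  proof -
    \<comment> \<open>Index 0 has no downward step, and the generator not occurring in
      \<open>\<epsilon> 0\<close> has no upward one, so it changes copy.\<close>
    have "rung \<epsilon> (\<not> fst (\<epsilon> 0)) True (0, False) = (0, True)"
      by (cases "\<epsilon> 0") (simp add: rung_def step_def)
    then show ?thesis
      using rung_orbit[of "\<not> fst (\<epsilon> 0)" "(0, False)"] by simp
  qed
  have "ladder (i, b) \<in> A \<longleftrightarrow> ladder (0, False) \<in> A" for i b
  proof (induction i)
    case 0
    then show ?case
      using zero by (cases b) simp_all
  next
    case (Suc i)
    then show ?case
      using \<open>\<And>i b. ladder (Suc i, b) \<in> A \<longleftrightarrow> ladder (i, b) \<in> A\<close> by simp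
  qed
  moreover have "ladder (0, False) = \<one>"
    by (simp add: ladder_def r_0)
  ultimately show ?thesis
    by (cases z) simp
qed

text \<open>A vertex off the ladder shares a star with its hub, for the generator selected by the
  parity of \<open>d (p u)\<close>. The hub is on the ladder or is the parent, which has smaller
  depth.\<close>

lemma orbit: "u \<in> carrier G \<Longrightarrow> u \<in> A \<longleftrightarrow> \<one> \<in> A"
proof (induction "d u" arbitrary: u rule: less_induct)
  case less
  show ?case
  proof (cases "u \<in> range ladder")
    case True
    then show ?thesis
      using ladder_orbit by auto
  next
    case False
    then have "star_root (even (d (p u))) u = hub u"
      by (simp add: star_root_def)
    then have "u \<in> A \<longleftrightarrow> hub u \<in> A"
      using star_root_orbit[OF less.prems] by metis
    also have "\<dots> \<longleftrightarrow> \<one> \<in> A"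
    proof (cases "\<exists>i. p u = ladder (i, False)")
      case True
      then show ?thesis
        using ladder_orbit by (auto simp: hub_ladder)
    next
      case noladder: False
      have "d (p u) < d u"
        using depth[OF less.prems] not_range_r_neq_one False range_ladder by simp
      with noladder less show ?thesis
        by (simp add: hub_p)
    qed
    finally show ?thesis .
  qed
qed

end

end

section \<open>The action\<close>

lemma BijGroup_mult_apply:
  "f \<in> carrier (BijGroup V) \<Longrightarrow> g \<in> carrier (BijGroup V) \<Longrightarrow> x \<in> V \<Longrightarrow> (f \<otimes>\<^bsub>BijGroup V\<^esub> g) x = f (g x)"
  by (simp add: BijGroup_def compose_def)

lemma BijGroup_one_apply: "x \<in> V \<Longrightarrow> \<one>\<^bsub>BijGroup V\<^esub> x = x"
  by (simp add: BijGroup_def)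

lemma BijGroup_bij_betw: "f \<in> carrier (BijGroup V) \<Longrightarrow> bij_betw f V V"
  by (simp add: BijGroup_def Bij_def)

lemma BijGroup_apply_closed: "f \<in> carrier (BijGroup V) \<Longrightarrow> x \<in> V \<Longrightarrow> f x \<in> V"
  using BijGroup_bij_betw by (blast dest: bij_betwE)

lemma BijGroup_inv_apply:
  assumes "f \<in> carrier (BijGroup V)" "x \<in> V"
  shows "(inv\<^bsub>BijGroup V\<^esub> f) (f x) = x" "f ((inv\<^bsub>BijGroup V\<^esub> f) x) = x"
proof -
  interpret group "BijGroup V"
    by (rule group_BijGroup)
  show "(inv\<^bsub>BijGroup V\<^esub> f) (f x) = x" "f ((inv\<^bsub>BijGroup V\<^esub> f) x) = x"
    using assms BijGroup_mult_apply[of "inv\<^bsub>BijGroup V\<^esub> f" V f x]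
      BijGroup_mult_apply[of f V "inv\<^bsub>BijGroup V\<^esub> f" x]
    by (simp_all add: BijGroup_one_apply)
qed

context group_with_ray
begin

sublocale perms: group "BijGroup (carrier G)"
  by (rule group_BijGroup)

text \<open>Elements of \<open>BijGroup\<close> are extensional, whence the restriction.\<close>

definition gen_perm :: "bool \<Rightarrow> 'a \<Rightarrow> 'a" where
  "gen_perm k = restrict (gen k) (carrier G)"

definition act :: "letter list \<Rightarrow> 'a \<Rightarrow> 'a" where
  "act = perms.word_map gen_perm"

lemma gen_perm_closed [simp]: "gen_perm k \<in> carrier (BijGroup (carrier G))"
  using gen_bij[of k] by (simp add: gen_perm_def BijGroup_def Bij_def bij_betw_restrict_eq)

lemma letter_closed [simp]: "perms.letter_map gen_perm l \<in> carrier (BijGroup (carrier G))"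
  by (rule perms.letter_map_closed) simp

lemma act_perm [simp]: "act w \<in> carrier (BijGroup (carrier G))"
  unfolding act_def by (rule perms.word_map_closed) simp

lemma act_closed [simp]: "x \<in> carrier G \<Longrightarrow> act w x \<in> carrier G"
  by (rule BijGroup_apply_closed[OF act_perm])

lemma act_hom: "act \<in> hom F2 (BijGroup (carrier G))"
  unfolding act_def by (rule perms.word_map_hom) simp

lemma act_Nil: "x \<in> carrier G \<Longrightarrow> act [] x = x"
  by (simp add: act_def BijGroup_one_apply)

lemma act_Cons: "x \<in> carrier G \<Longrightarrow> act (l # w) x = perms.letter_map gen_perm l (act w x)"
  using act_perm[of w] by (simp add: act_def BijGroup_mult_apply)

lemma act_red_cons:
  assumes "x \<in> carrier G"
  shows "act (red_cons l w) x = perms.letter_map gen_perm l (act w x)"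
proof -
  have "act (red_cons l w) = act (l # w)"
    by (simp add: act_def perms.word_map_red_cons)
  then show ?thesis
    using act_Cons[OF assms] by simp
qed

lemma letter_True: "x \<in> carrier G \<Longrightarrow> perms.letter_map gen_perm (k, True) x = gen k x"
  by (simp add: perms.letter_map_def gen_perm_def)

lemma letter_False:
  assumes "x \<in> carrier G"
  shows "perms.letter_map gen_perm (k, False) (gen k x) = x"
proof -
  have "gen k x = gen_perm k x"
    using assms by (simp add: gen_perm_def)
  then show ?thesis
    using BijGroup_inv_apply(1)[OF gen_perm_closed assms] by (simp add: perms.letter_map_def)
qed

lemma letter_ladder: "perms.letter_map gen_perm (\<epsilon> i) (ladder (Suc i, False)) = ladder (i, False)"
proof (cases "\<epsilon> i")
  case (Pair k s)
  show ?thesis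
  proof (cases s)
    case True
    with Pair show ?thesis
      by (simp add: letter_True gen_ladder_True)
  next
    case False
    with Pair show ?thesis
      using letter_False[of "ladder (i, False)" k] by (simp add: gen_ladder_False)
  qed
qed

text \<open>The last letter acts first, so a factor \<open>w\<close> of \<open>\<epsilon>\<close>
  starting at \<open>i\<close> lowers the index by one with each of its letters.\<close>

lemma act_ladder:
  "(\<And>j. j < length w \<Longrightarrow> \<epsilon> (i + j) = w ! j) \<Longrightarrow>
    act w (ladder (i + length w, False)) = ladder (i, False)"
proof (induction w arbitrary: i)
  case Nil
  then show ?case
    by (simp add: act_Nil)
next
  case (Cons l w)
  have "act w (ladder (Suc i + length w, False)) = ladder (Suc i, False)"
    using Cons.prems[of "Suc j" for j] by (intro Cons.IH) simp
  moreover have "\<epsilon> i = l"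
    using Cons.prems[of 0] by simp
  ultimately show ?case
    using letter_ladder[of i] by (simp add: act_Cons)
qed

lemma faithful: "faithful_action (carrier G) act"
  unfolding faithful_action_def
proof (intro ballI impI)
  fix w assume "w \<in> carrier F2" "w \<noteq> \<one>\<^bsub>F2\<^esub>"
  then have w: "reduced_word w" "w \<noteq> []"
    by (simp_all add: F2_def)
  then obtain i where "\<And>j. j < length w \<Longrightarrow> \<epsilon> (i + j) = w ! j"
    using universal by blast
  then have "act w (ladder (i + length w, False)) \<noteq> ladder (i + length w, False)"
    using w act_ladder[of w i] by simp
  then show "\<exists>x\<in>carrier G. act w x \<noteq> x"
    using ladder_closed by blast
qed

lemma transitive: "transitive_action (carrier G) act"
  unfolding transitive_action_def
proof (intro ballI)
  fix x y assume x: "x \<in> carrier G" and y: "y \<in> carrier G"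
  \<comment> \<open>The orbit of \<open>x\<close>. As \<open>red_cons\<close> keeps words reduced,
    it is closed under all four letters, hence invariant under the generators in both
    directions.\<close>
  define A where "A = {act w x | w. reduced_word w}"
  have letter_A: "perms.letter_map gen_perm l z \<in> A" if "z \<in> A" for l z
  proof -
    obtain w where w: "reduced_word w" "z = act w x"
      using \<open>z \<in> A\<close> by (auto simp: A_def)
    then have "perms.letter_map gen_perm l z = act (red_cons l w) x"
      by (simp add: act_red_cons[OF x])
    then show ?thesis
      using reduced_word_red_cons[OF w(1)] unfolding A_def by blast
  qed
  have A: "gen k z \<in> A \<longleftrightarrow> z \<in> A" if "z \<in> carrier G" for k z
    using letter_A[of z "(k, True)"] letter_A[of "gen k z" "(k, False)"] that
    by (auto simp: letter_True letter_False)
  have "reduced_word []"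
    by (simp add: reduced_word_def)
  then have "act [] x \<in> A"
    unfolding A_def by blast
  then have "x \<in> A"
    by (simp only: act_Nil[OF x])
  then have "y \<in> A"
    using orbit[OF A x] orbit[OF A y] by simp
  then show "\<exists>w\<in>carrier F2. act w x = y"
    by (auto simp: A_def F2_def)
qed

lemma letter_controlled: "controlled (graph_of (perms.letter_map gen_perm l))"
proof (cases l)
  case (Pair k s)
  have *: "controlled (graph_of (gen_perm k))"
    using gen_controlled[of k] by (rule controlled_subset) (auto simp: graph_of_def gen_perm_def)
  have "graph_of (inv\<^bsub>BijGroup (carrier G)\<^esub> (gen_perm k)) \<subseteq> (graph_of (gen_perm k))\<inverse>"
  proof
    fix z assume "z \<in> graph_of (inv\<^bsub>BijGroup (carrier G)\<^esub> (gen_perm k))"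
    then obtain x where x: "x \<in> carrier G" "z = (x, (inv\<^bsub>BijGroup (carrier G)\<^esub> (gen_perm k)) x)"
      by (auto simp: graph_of_def)
    then show "z \<in> (graph_of (gen_perm k))\<inverse>"
      using BijGroup_inv_apply(2)[OF gen_perm_closed[of k] x(1)]
        BijGroup_apply_closed[OF perms.inv_closed[OF gen_perm_closed[of k]] x(1)]
      by (force simp: graph_of_def)
  qed
  then have "controlled (graph_of (inv\<^bsub>BijGroup (carrier G)\<^esub> (gen_perm k)))"
    using * controlled_converse controlled_subset by blast
  with * Pair show ?thesis
    by (simp add: perms.letter_map_def)
qed

lemma act_controlled: "controlled (graph_of (act w))"
proof (induction w)
  case Nil
  have "graph_of (act []) \<subseteq> Id_on (carrier G)"
    unfolding graph_of_def using act_Nil by auto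
  then show ?case
    by (rule controlled_subset[OF controlled_Id_on])
next
  case (Cons l w)
  have "graph_of (act (l # w)) \<subseteq> graph_of (act w) O graph_of (perms.letter_map gen_perm l)"
  proof
    fix z assume "z \<in> graph_of (act (l # w))"
    then obtain x where x: "x \<in> carrier G" "z = (x, perms.letter_map gen_perm l (act w x))"
      by (auto simp: graph_of_def act_Cons)
    have "(x, act w x) \<in> graph_of (act w)"
      and "(act w x, perms.letter_map gen_perm l (act w x)) \<in> graph_of (perms.letter_map gen_perm l)"
      using x(1) act_closed[OF x(1), of w] unfolding graph_of_def by blast+
    then show "z \<in> graph_of (act w) O graph_of (perms.letter_map gen_perm l)"
      unfolding x(2) by (rule relcompI)
  qed
  then show ?case
    using controlled_relcomp[OF Cons letter_controlled] controlled_subset by blast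
qed

lemma act_invariant: "H_invariant_mean G \<mu> \<Longrightarrow> F2_invariant_mean G act \<mu>"
  unfolding F2_invariant_mean_def
  by (intro ballI allI impI invariant_mean_bounded_displacement
    BijGroup_bij_betw[OF act_perm] act_controlled)

end

theorem theorem6p1:
  fixes H :: "('a, 'b) monoid_scheme"
  assumes "group H"
    and "infinite (carrier H)"
    and "finitely_generated H"
    and "amenable H"
  shows "\<exists>\<phi>. \<phi> \<in> hom F2 (BijGroup (carrier H)) \<and>
             faithful_action (carrier H) \<phi> \<and>
             transitive_action (carrier H) \<phi> \<and>
             (\<forall>\<mu>. H_invariant_mean H \<mu> \<longrightarrow> F2_invariant_mean H \<phi> \<mu>)"
proof -
  interpret group H
    by (rule assms(1))
  obtain S where "finite S" "S \<subseteq> carrier H" "generate H S = carrier H"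
    using assms(3) unfolding finitely_generated_def by blast
  from ex_spanning_tree[OF this] obtain p and d :: "'a \<Rightarrow> nat"
    where p: "p \<one>\<^bsub>H\<^esub> = \<one>\<^bsub>H\<^esub>" "\<And>x. x \<in> carrier H \<Longrightarrow> x \<noteq> \<one>\<^bsub>H\<^esub> \<Longrightarrow> d x = Suc (d (p x))"
      "controlled (graph_of p)"
    by blast
  from ex_ray[of p d, OF assms(2) p] obtain r :: "nat \<Rightarrow> 'a"
    where r: "r 0 = \<one>\<^bsub>H\<^esub>" "\<And>n. r n \<in> carrier H \<and> r (Suc n) \<noteq> \<one>\<^bsub>H\<^esub> \<and> p (r (Suc n)) = r n"
    by blast
  obtain \<epsilon> :: "nat \<Rightarrow> letter" where \<epsilon>: "\<And>i. \<epsilon> (Suc i) \<noteq> inv_letter (\<epsilon> i)"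
    "\<And>w. reduced_word w \<Longrightarrow> \<exists>i. \<forall>j<length w. \<epsilon> (i + j) = w ! j"
    using ex_universal_reduced_sequence by blast
  interpret group_with_ray H p d r \<epsilon>
    by unfold_locales (use p r \<epsilon> in blast)+
  show ?thesis
    using act_hom faithful transitive act_invariant by blast
qed

end
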